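(* Let $q$ be a prime power and let $k,n\in\mathbb{N}_0$ be such that $0\leq k\leq n$. Let $U$ be an $(n-k)$-dimensional linear subspace of $\mathbb{F}_q^n$, and let $\chi:\mathbb{F}_q\to S^1\subseteq\mathbb{C}$ be a nontrivial additive character. If $x\in\mathbb{F}_q^n$ and $x\notin U$, then $$\sum_{y\in U^\perp}\chi(-x\cdot y)=0.$$
   Context: $\mathbb{F}_q$ is the finite field with $q$ elements, $\mathbb{N}_0$ is the set of non-negative integers, $x\cdot y\in\mathbb{F}_q$ is the usual dot product on $\mathbb{F}_q^n$, and $U^\perp=\{y\in\mathbb{F}_q^n: x\cdot y=0\text{ for all }x\in U\}$. *)

theory Defs
  imports Complex_Main "HOL-Number_Theory.Prime_Powers" "Jordan_Normal_Form.VS_Connect"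
begin

definition additive_character :: "('a::field \<Rightarrow> complex) \<Rightarrow> bool" where
  "additive_character \<chi> \<longleftrightarrow>
     (\<forall>a. cmod (\<chi> a) = 1) \<and> (\<forall>a b. \<chi> (a + b) = \<chi> a * \<chi> b)"

definition nontrivial_additive_character :: "('a::field \<Rightarrow> complex) \<Rightarrow> bool" where
  "nontrivial_additive_character \<chi> \<longleftrightarrow> additive_character \<chi> \<and> (\<exists>a. \<chi> a \<noteq> 1)"

text \<open>A subspace of \<open>'a\<^sup>n\<close> is given by its carrier set. Vectors have a term-level length, so that
  \<open>n = 0\<close> is allowed, in contrast to the type \<open>'a ^ 'n\<close>. The dimension of \<open>U\<close> is that of the vector
  space record obtained by restricting the carrier to \<open>U\<close>; it is only meaningful for a subspace.\<close>

definition subspace_of_dim :: "nat \<Rightarrow> nat \<Rightarrow> 'a::field vec set \<Rightarrow> bool" where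
  "subspace_of_dim n d U \<longleftrightarrow>
     VectorSpace.subspace class_ring U (module_vec TYPE('a) n) \<and>
     vectorspace.dim class_ring (module_vec TYPE('a) n\<lparr>carrier := U\<rparr>) = d"

text \<open>\<open>perp n U\<close> is the set of all \<open>y\<close> in \<^term>\<open>carrier_vec n\<close> with \<open>y \<bullet> x = 0\<close> for all
  \<open>x \<in> U\<close>; the scalar product is the bilinear (not conjugated) one.\<close>

abbreviation perp :: "nat \<Rightarrow> 'a::field vec set \<Rightarrow> 'a vec set" where
  "perp n U \<equiv> vec_module.orthogonal_complement n U"

end

(* Some z in U^perp satisfies x . z \<noteq> 0, and after rescaling z we may assume \<chi>(-x . z) \<noteq> 1.
   Translating the summation variable by z multiplies the sum by \<chi>(-x . z), so the sum is 0.
   To find z, let W be maximal among the subspaces that contain U but not x. By maximality every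
   vector v is congruent modulo W to exactly one multiple f(v) x; the map f is a linear
   functional, hence the scalar product with some z; it vanishes on U, and f(x) = 1. *)

theory Submission
  imports Defs
begin

text \<open>Since \<open>module_vec\<close> always satisfies the vector space axioms, being a
  subspace reduces to closure conditions, a form that \<open>auto\<close> and \<open>blast\<close>
  can use directly.\<close>

lemma subspace_module_vec_iff:
  fixes W :: "'a::field vec set"
  shows "VectorSpace.subspace class_ring W (module_vec TYPE('a) n) \<longleftrightarrow>
    W \<subseteq> carrier_vec n \<and> 0\<^sub>v n \<in> W \<and> (\<forall>v\<in>W. \<forall>w\<in>W. v + w \<in> W) \<and> (\<forall>a. \<forall>v\<in>W. a \<cdot>\<^sub>v v \<in> W)"
proof -
  interpret vec_space "TYPE('a)" n .
  show ?thesis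
    using vec_vs module_axioms
    by (auto simp: VectorSpace.subspace_def submodule_def class_ring_simps module_vec_simps)
qed

text \<open>A linear functional is determined by its values on the unit vectors, and these values
  are the coordinates of the representing vector.\<close>

lemma linear_functional_eq_scalar_prod:
  fixes f :: "'a::comm_ring_1 vec \<Rightarrow> 'a"
  assumes add: "\<And>v w. v \<in> carrier_vec n \<Longrightarrow> w \<in> carrier_vec n \<Longrightarrow> f (v + w) = f v + f w"
    and smult: "\<And>a v. v \<in> carrier_vec n \<Longrightarrow> f (a \<cdot>\<^sub>v v) = a * f v"
  obtains y where "y \<in> carrier_vec n" "\<And>v. v \<in> carrier_vec n \<Longrightarrow> f v = v \<bullet> y"
proof
  let ?y = "vec n (\<lambda>i. f (unit_vec n i))"
  show "?y \<in> carrier_vec n" by simp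
  fix v :: "'a vec" assume v: "v \<in> carrier_vec n"
  \<comment> \<open>Keeping only the first \<open>m\<close> coordinates of \<open>v\<close> allows
    an induction on \<open>m\<close> from the zero vector up to \<open>v\<close>, which avoids
    finite sums of vectors.\<close>
  let ?trunc = "\<lambda>m. vec n (\<lambda>i. if i < m then v $ i else 0)"
  have "f (?trunc m) = (\<Sum>i<m. v $ i * f (unit_vec n i))" if "m \<le> n" for m
    using that
  proof (induction m)
    case 0
    \<comment> \<open>Written as a multiple by 0 so that homogeneity alone makes the value of
      \<open>f\<close> vanish.\<close>
    have "?trunc 0 = 0 \<cdot>\<^sub>v 0\<^sub>v n" by auto
    then show ?case using smult[of "0\<^sub>v n" 0] by simp
  next
    case (Suc m)
    have "?trunc (Suc m) = ?trunc m + v $ m \<cdot>\<^sub>v unit_vec n m"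
      by (rule eq_vecI) (use Suc.prems in \<open>auto simp: less_Suc_eq\<close>)
    then show ?case using Suc by (simp add: add smult)
  qed
  moreover have "?trunc n = v" using v by auto
  ultimately have "f v = (\<Sum>i<n. v $ i * f (unit_vec n i))" by (metis order_refl)
  then show "f v = v \<bullet> ?y"
    by (simp add: scalar_prod_def lessThan_atLeast0)
qed

text \<open>Zorn's lemma applies because the union of a nonempty chain of subspaces containing
  \<open>U\<close> but not \<open>x\<close> is again such a subspace.\<close>

lemma maximal_subspace_avoiding:
  fixes U :: "'a::field vec set"
  assumes U: "VectorSpace.subspace class_ring U (module_vec TYPE('a) n)" and x: "x \<notin> U"
  obtains W where "VectorSpace.subspace class_ring W (module_vec TYPE('a) n)" "U \<subseteq> W" "x \<notin> W"
    "\<And>X. VectorSpace.subspace class_ring X (module_vec TYPE('a) n) \<Longrightarrow> W \<subseteq> X \<Longrightarrow> x \<notin> X \<Longrightarrow> X = W"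
proof -
  define F where
    "F = {W. VectorSpace.subspace class_ring W (module_vec TYPE('a) n) \<and> U \<subseteq> W \<and> x \<notin> W}"
  have "\<exists>W\<in>F. \<forall>X\<in>F. W \<subseteq> X \<longrightarrow> X = W"
  proof (rule subset_Zorn_nonempty)
    show "F \<noteq> {}" using U x by (auto simp: F_def)
    fix C assume "C \<noteq> {}" and "subset.chain F C"
    then obtain A where A: "A \<in> C" and C: "C \<subseteq> F" and
      linear: "\<And>X Y. X \<in> C \<Longrightarrow> Y \<in> C \<Longrightarrow> X \<subseteq> Y \<or> Y \<subseteq> X"
      by (auto simp: subset_chain_def)
    have sub: "VectorSpace.subspace class_ring X (module_vec TYPE('a) n)" "U \<subseteq> X" "x \<notin> X"
      if "X \<in> C" for X
      using that C by (auto simp: F_def)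
    \<comment> \<open>Closure under addition is where the linear order of the chain matters: the
      larger of two members contains both summands.\<close>
    have "v + w \<in> \<Union> C" if vw: "v \<in> \<Union> C" "w \<in> \<Union> C" for v w
    proof -
      obtain X Y where XY: "X \<in> C" "Y \<in> C" "v \<in> X" "w \<in> Y" using vw by blast
      then obtain Z where "Z \<in> C" "v \<in> Z" "w \<in> Z" using linear[of X Y] by auto
      then show ?thesis using sub(1)[of Z] by (auto simp: subspace_module_vec_iff)
    qed
    moreover have "\<Union> C \<subseteq> carrier_vec n"
      using sub(1) unfolding subspace_module_vec_iff by blast
    \<comment> \<open>These two facts need a member of the chain, namely \<open>A\<close>.\<close>
    moreover have "0\<^sub>v n \<in> \<Union> C" "U \<subseteq> \<Union> C"
      using sub(1,2) A by (auto simp: subspace_module_vec_iff)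
    moreover have "a \<cdot>\<^sub>v v \<in> \<Union> C" if "v \<in> \<Union> C" for a v
      using that sub(1) unfolding subspace_module_vec_iff by blast
    moreover have "x \<notin> \<Union> C" using sub(3) by auto
    ultimately show "\<Union> C \<in> F" by (auto simp: F_def subspace_module_vec_iff)
  qed
  then show ?thesis using that by (auto simp: F_def)
qed

text \<open>The maximal subspace \<open>W\<close> is the kernel of the functional built here. The
  value 1 is a normalisation: rescaling \<open>y\<close> then yields any prescribed scalar product
  with \<open>x\<close>.\<close>

lemma exists_perp_scalar_prod_eq_1:
  fixes U :: "'a::field vec set"
  assumes U: "VectorSpace.subspace class_ring U (module_vec TYPE('a) n)"
    and x: "x \<in> carrier_vec n" "x \<notin> U"
  obtains y where "y \<in> perp n U" "x \<bullet> y = 1"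
proof -
  obtain W where sub: "VectorSpace.subspace class_ring W (module_vec TYPE('a) n)"
    and UW: "U \<subseteq> W" and xW: "x \<notin> W"
    and max: "\<And>X. VectorSpace.subspace class_ring X (module_vec TYPE('a) n) \<Longrightarrow> W \<subseteq> X \<Longrightarrow> x \<notin> X \<Longrightarrow> X = W"
    using maximal_subspace_avoiding[OF U x(2)] by blast
  have W: "W \<subseteq> carrier_vec n" and zero: "0\<^sub>v n \<in> W"
    and add: "\<And>v w. v \<in> W \<Longrightarrow> w \<in> W \<Longrightarrow> v + w \<in> W" and smult: "\<And>a v. v \<in> W \<Longrightarrow> a \<cdot>\<^sub>v v \<in> W"
    using sub by (auto simp: subspace_module_vec_iff)
  have decomp: "\<exists>a. v + (- a) \<cdot>\<^sub>v x \<in> W" if v: "v \<in> carrier_vec n" for v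
  proof (cases "v \<in> W")
    case True
    then have "v + (- 0) \<cdot>\<^sub>v x = v" using v x by auto
    then show ?thesis using True by metis
  next
    case False
    \<comment> \<open>\<open>X\<close> is the span of \<open>W\<close> and \<open>v\<close>. It is
      strictly larger than \<open>W\<close>, so by maximality it must contain
      \<open>x\<close>.\<close>
    define X where "X = {w + b \<cdot>\<^sub>v v | w b. w \<in> W}"
    have inX: "w + b \<cdot>\<^sub>v v \<in> X" if "w \<in> W" for w b using that by (auto simp: X_def)
    have zero_coeff: "w + 0 \<cdot>\<^sub>v v = w" if "w \<in> W" for w
      by (rule eq_vecI) (use that W v in auto)
    have WX: "w \<in> X" if "w \<in> W" for w
      using inX[OF that, of 0] zero_coeff[OF that] by simp
    have "VectorSpace.subspace class_ring X (module_vec TYPE('a) n)"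
      unfolding subspace_module_vec_iff
    proof (intro conjI allI ballI)
      show "X \<subseteq> carrier_vec n" using W v by (auto simp: X_def)
      show "0\<^sub>v n \<in> X" using WX zero by blast
    next
      fix s t assume "s \<in> X" "t \<in> X"
      then obtain w b w' b' where *: "s = w + b \<cdot>\<^sub>v v" "t = w' + b' \<cdot>\<^sub>v v" "w \<in> W" "w' \<in> W"
        by (auto simp: X_def)
      have "s + t = (w + w') + (b + b') \<cdot>\<^sub>v v"
        by (rule eq_vecI) (use * W v in \<open>auto simp: algebra_simps\<close>)
      then show "s + t \<in> X" using inX[OF add] * by simp
    next
      fix a s assume "s \<in> X"
      then obtain w b where *: "s = w + b \<cdot>\<^sub>v v" "w \<in> W"
        by (auto simp: X_def)
      have "a \<cdot>\<^sub>v s = a \<cdot>\<^sub>v w + (a * b) \<cdot>\<^sub>v v"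
        by (rule eq_vecI) (use * W v in \<open>auto simp: algebra_simps\<close>)
      then show "a \<cdot>\<^sub>v s \<in> X" using inX[OF smult] * by simp
    qed
    moreover have "v \<in> X"
    proof -
      have "0\<^sub>v n + 1 \<cdot>\<^sub>v v = v" using v by auto
      then show ?thesis using inX[OF zero, of 1] by simp
    qed
    ultimately have "x \<in> X" using max[of X] WX False by blast
    then obtain w b where xw: "x = w + b \<cdot>\<^sub>v v" and w: "w \<in> W" by (auto simp: X_def)
    have "b \<noteq> 0"
    proof
      assume "b = 0"
      then have "x = w" using xw zero_coeff[OF w] by simp
      then show False using w xW by simp
    qed
    \<comment> \<open>Solving \<open>x = w + b \<cdot>\<^sub>v v\<close> for \<open>v\<close> shows
      that the coefficient of \<open>x\<close> is \<open>inverse b\<close>.\<close>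
    then have "v + (- inverse b) \<cdot>\<^sub>v x = (- inverse b) \<cdot>\<^sub>v w"
      unfolding xw by (intro eq_vecI) (use w W v in \<open>auto simp: field_simps\<close>)
    then show ?thesis using smult[OF w] by metis
  qed
  have unique: "a = b"
    if v: "v \<in> carrier_vec n" and a: "v + (- a) \<cdot>\<^sub>v x \<in> W" and b: "v + (- b) \<cdot>\<^sub>v x \<in> W" for v a b
  proof (rule ccontr)
    assume "a \<noteq> b"
    then have ab: "b - a \<noteq> 0" by simp
    \<comment> \<open>Subtracting the two elements of \<open>W\<close> cancels \<open>v\<close> and
      leaves \<open>(b - a) \<cdot>\<^sub>v x\<close>; dividing by the nonzero scalar would put
      \<open>x\<close> into \<open>W\<close>.\<close>
    have "x = inverse (b - a) \<cdot>\<^sub>v ((v + (- a) \<cdot>\<^sub>v x) + (- 1) \<cdot>\<^sub>v (v + (- b) \<cdot>\<^sub>v x))"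
    proof (rule eq_vecI)
      fix i assume "i < dim_vec (inverse (b - a) \<cdot>\<^sub>v ((v + (- a) \<cdot>\<^sub>v x) + (- 1) \<cdot>\<^sub>v (v + (- b) \<cdot>\<^sub>v x)))"
      then have i: "i < n" using x by simp
      have "x $ i = inverse (b - a) * ((b - a) * x $ i)" using ab by simp
      also have "(b - a) * x $ i = (v $ i - a * x $ i) + (- 1) * (v $ i - b * x $ i)"
        by (simp add: algebra_simps)
      finally show "x $ i =
          (inverse (b - a) \<cdot>\<^sub>v ((v + (- a) \<cdot>\<^sub>v x) + (- 1) \<cdot>\<^sub>v (v + (- b) \<cdot>\<^sub>v x))) $ i"
        using i v x by simp
    qed (use x in simp)
    then show False using smult[OF add[OF a smult[OF b]]] xW by metis
  qed
  obtain f where f: "\<And>v. v \<in> carrier_vec n \<Longrightarrow> v + (- f v) \<cdot>\<^sub>v x \<in> W"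
    using decomp by metis
  \<comment> \<open>Linearity comes from uniqueness: the expected value is also a coefficient that
    brings the vector into \<open>W\<close>. Homogeneity below is obtained in the same way.\<close>
  have f_add: "f (v + w) = f v + f w" if "v \<in> carrier_vec n" "w \<in> carrier_vec n" for v w
  proof -
    have "(v + w) + (- (f v + f w)) \<cdot>\<^sub>v x = (v + (- f v) \<cdot>\<^sub>v x) + (w + (- f w) \<cdot>\<^sub>v x)"
      by (rule eq_vecI) (use that x in \<open>auto simp: algebra_simps\<close>)
    then show ?thesis using unique[of "v + w"] f add that by (metis add_carrier_vec)
  qed
  have f_smult: "f (a \<cdot>\<^sub>v v) = a * f v" if "v \<in> carrier_vec n" for a v
  proof -
    have "a \<cdot>\<^sub>v v + (- (a * f v)) \<cdot>\<^sub>v x = a \<cdot>\<^sub>v (v + (- f v) \<cdot>\<^sub>v x)"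
      by (rule eq_vecI) (use that x in \<open>auto simp: algebra_simps\<close>)
    then show ?thesis using unique[of "a \<cdot>\<^sub>v v"] f smult that by (metis smult_carrier_vec)
  qed
  obtain y where y: "y \<in> carrier_vec n" and fy: "\<And>v. v \<in> carrier_vec n \<Longrightarrow> f v = v \<bullet> y"
    using linear_functional_eq_scalar_prod[of n f] f_add f_smult by metis
  \<comment> \<open>A vector of \<open>U\<close> already lies in \<open>W\<close>, so its
    coefficient is 0.\<close>
  have "v \<bullet> y = 0" if "v \<in> U" for v
  proof -
    have v: "v \<in> W" "v \<in> carrier_vec n" using that UW W by auto
    then have "v + (- 0) \<cdot>\<^sub>v x = v" using x by auto
    then have "f v = 0" using unique[OF v(2) f[OF v(2)], of 0] v(1) by simp
    then show ?thesis using fy v by simp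
  qed
  \<comment> \<open>The orthogonal complement has the factors of the scalar product in the other
    order, hence the appeal to commutativity.\<close>
  then have "y \<in> perp n U"
    using y UW W by (auto simp: vec_module.orthogonal_complement_def comm_scalar_prod[of y n])
  moreover have "x \<bullet> y = 1"
  proof -
    have "x + (- 1) \<cdot>\<^sub>v x = 0\<^sub>v n" using x by auto
    then have "f x = 1" using unique[OF x(1) f[OF x(1)], of 1] zero by simp
    then show ?thesis using fy x by simp
  qed
  ultimately show ?thesis using that by blast
qed

text \<open>The complement is closed under addition and subtraction, so translation by
  \<open>z\<close> is inverted by translation by \<open>-z\<close>. This justifies the shift of the
  summation variable.\<close>

lemma bij_betw_add_perp:
  assumes z: "z \<in> perp n U" and U: "U \<subseteq> carrier_vec n"
  shows "bij_betw (\<lambda>y. y + z) (perp n U) (perp n U)"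
proof (rule bij_betw_byWitness[where f' = "\<lambda>y. y - z"])
  show "\<forall>y\<in>perp n U. (y + z) - z = y" "\<forall>y\<in>perp n U. (y - z) + z = y"
    using z by (auto simp: vec_module.orthogonal_complement_def)
  show "(\<lambda>y. y + z) ` perp n U \<subseteq> perp n U"
    using z U by (auto simp: vec_module.orthogonal_complement_def add_scalar_prod_distrib[of _ n])
  show "(\<lambda>y. y - z) ` perp n U \<subseteq> perp n U"
    using z U by (auto simp: vec_module.orthogonal_complement_def minus_scalar_prod_distrib[of _ n])
qed

theorem lemma4p1:
  fixes q k n :: nat
    and U :: "'a::{finite, field} vec set"
    and \<chi> :: "'a \<Rightarrow> complex"
    and x :: "'a vec"
  assumes "primepow q"
    and "card (UNIV :: 'a set) = q"
    and "k \<le> n"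
    and "subspace_of_dim n (n - k) U"
    and "nontrivial_additive_character \<chi>"
    and "x \<in> carrier_vec n"
    and "x \<notin> U"
  shows "(\<Sum>y\<in>perp n U. \<chi> (- (x \<bullet> y))) = 0"
proof -
  let ?S = "\<Sum>y\<in>perp n U. \<chi> (- (x \<bullet> y))"
  have sub: "VectorSpace.subspace class_ring U (module_vec TYPE('a) n)"
    using assms(4) by (simp add: subspace_of_dim_def)
  then have U: "U \<subseteq> carrier_vec n" by (simp add: subspace_module_vec_iff)
  obtain y where y: "y \<in> perp n U" "x \<bullet> y = 1"
    using exists_perp_scalar_prod_eq_1[OF sub assms(6,7)] .
  obtain a where a: "\<chi> a \<noteq> 1" and mult: "\<And>a b. \<chi> (a + b) = \<chi> a * \<chi> b"
    using assms(5) by (auto simp: nontrivial_additive_character_def additive_character_def)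
  \<comment> \<open>The factor \<open>- a\<close> is chosen so that
    \<open>- (x \<bullet> z) = a\<close>, an argument at which \<chi> differs from 1.\<close>
  define z where "z = (- a) \<cdot>\<^sub>v y"
  have z: "z \<in> perp n U"
    using y U by (auto simp: z_def vec_module.orthogonal_complement_def subset_iff)
  have xz: "x \<bullet> z = - a"
    using y assms(6) by (auto simp: z_def vec_module.orthogonal_complement_def)
  have "?S = (\<Sum>y\<in>perp n U. \<chi> (- (x \<bullet> (y + z))))"
    by (rule sum.reindex_bij_betw[OF bij_betw_add_perp[OF z U], symmetric])
  also have "\<dots> = (\<Sum>y\<in>perp n U. \<chi> (- (x \<bullet> y)) * \<chi> a)"
  proof (rule sum.cong[OF refl])
    fix y assume "y \<in> perp n U"
    then have "x \<bullet> (y + z) = x \<bullet> y - a"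
      using z xz assms(6)
      by (simp add: vec_module.orthogonal_complement_def scalar_prod_add_distrib[of x n])
    then show "\<chi> (- (x \<bullet> (y + z))) = \<chi> (- (x \<bullet> y)) * \<chi> a"
      using mult[of "- (x \<bullet> y)" a] by simp
  qed
  also have "\<dots> = ?S * \<chi> a" by (rule sum_distrib_right[symmetric])
  \<comment> \<open>The sum equals itself times \<open>\<chi> a\<close>, and \<open>\<chi> a\<close>
    is not 1, so the sum vanishes.\<close>
  finally show ?thesis using a by simp
qed

end
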